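(* Let $\langle A;\cdot,0,\Diamond\rangle$ be a monadic quasi-implication algebra. Define $1:=x\cdot x$, $x^*:=x\cdot 0$, $x\oplus y:=((x\cdot y)\cdot(y\cdot x))\cdot x$, and $x\odot y:=(x^*\oplus y^* )^*$. Then $\langle A;\odot,\oplus,^*,0,1,\Diamond\rangle$ is a quantum monadic algebra (with $\odot$ as meet and $\oplus$ as join).
   Context: A quasi-implication algebra is a magma $\langle A;\cdot\rangle$ satisfying, for all $x,y,z$: (1) $(x\cdot y)\cdot x=x$; (2) $(x\cdot y)\cdot(x\cdot z)=(y\cdot x)\cdot(y\cdot z)$; (3) $((x\cdot y)\cdot(y\cdot x))\cdot x=((y\cdot x)\cdot(x\cdot y))\cdot y$. In any quasi-implication algebra $x\cdot x=y\cdot y$ for all $x,y$, so $1$ is well defined. A bounded quasi-implication algebra is a quasi-implication algebra with a distinguished element $0$ such that $0\cdot x=1$ for all $x$. A monadic quasi-implication algebra is an algebra $\langle A;\cdot,0,\Diamond\rangle$ such that $\langle A;\cdot,0\rangle$ is a bounded quasi-implication algebra and $\Diamond\colon A\to A$ satisfies, for all $x,y$: (a) $\Diamond\Diamond x\cdot\Diamond x=1$ and $x\cdot\Diamond x=1$; (b) $\Diamond(\Diamond x\cdot 0)=\Diamond x\cdot 0$ and $\Diamond 0=0$; (c) $\Diamond(((x\cdot 0)\cdot(y\cdot 0))\cdot x)=((\Diamond x\cdot 0)\cdot(\Diamond y\cdot 0))\cdot\Diamond x$. An ortholattice is a bounded lattice $\langle A;\wedge,\vee,0,1\rangle$ with a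 unary operation $^{\perp}$ such that $x\wedge x^{\perp}=0$, $x\vee x^{\perp}=1$, $x\le y\Rightarrow y^{\perp}\le x^{\perp}$, and $x^{\perp\perp}=x$. An orthomodular lattice is an ortholattice satisfying: $x\le y$ implies $y=x\vee(x^{\perp}\wedge y)$. A quantum monadic algebra is an orthomodular lattice with a unary operation $\exists$ satisfying for all $x,y$: $\exists 0=0$; $x\le\exists x$; $\exists(x\vee y)=\exists x\vee\exists y$; $\exists\exists x=\exists x$; $\exists((\exists x)^{\perp})=(\exists x)^{\perp}$. *)

theory Defs
  imports "HOL-Library.Complemented_Lattices"
begin

locale quasi_implication_algebra =
  fixes dot :: "'a \<Rightarrow> 'a \<Rightarrow> 'a"  (infixl "\<cdot>" 70)
  assumes absorb: "(x \<cdot> y) \<cdot> x = x"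
    and dot_exchange: "(x \<cdot> y) \<cdot> (x \<cdot> z) = (y \<cdot> x) \<cdot> (y \<cdot> z)"
    and join_exchange: "((x \<cdot> y) \<cdot> (y \<cdot> x)) \<cdot> x = ((y \<cdot> x) \<cdot> (x \<cdot> y)) \<cdot> y"

text \<open>The constant common value of \<open>x \<cdot> x\<close>; the lemmas below show that it is well defined.\<close>

definition qia_one :: "('a \<Rightarrow> 'a \<Rightarrow> 'a) \<Rightarrow> 'a" where
  "qia_one dot = (THE e. \<forall>x. dot x x = e)"

context quasi_implication_algebra
begin

lemma dot_self_eq: "x \<cdot> x = y \<cdot> y"
  by (metis absorb join_exchange)

lemma dot_self: "x \<cdot> x = qia_one (\<cdot>)"
proof -
  have "(THE e. \<forall>y. y \<cdot> y = e) = x \<cdot> x"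
    by (rule the_equality) (metis dot_self_eq)+
  then show ?thesis
    by (simp add: qia_one_def)
qed

end

locale bounded_quasi_implication_algebra = quasi_implication_algebra dot
  for dot :: "'a \<Rightarrow> 'a \<Rightarrow> 'a"  (infixl "\<cdot>" 70) +
  fixes zero :: 'a  ("\<zero>")
  assumes zero_dot: "\<zero> \<cdot> x = qia_one (\<cdot>)"

locale monadic_quasi_implication_algebra = bounded_quasi_implication_algebra dot zero
  for dot :: "'a \<Rightarrow> 'a \<Rightarrow> 'a"  (infixl "\<cdot>" 70)
    and zero :: 'a  ("\<zero>") +
  fixes dia :: "'a \<Rightarrow> 'a"  ("\<diamond>_" [90] 90)
  assumes dia_dia_dot: "\<diamond>\<diamond>x \<cdot> \<diamond>x = qia_one (\<cdot>)"
    and dot_dia: "x \<cdot> \<diamond>x = qia_one (\<cdot>)"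
    and dia_compl_dia: "\<diamond>(\<diamond>x \<cdot> \<zero>) = \<diamond>x \<cdot> \<zero>"
    and dia_zero: "\<diamond>\<zero> = \<zero>"
    and dia_join: "\<diamond>(((x \<cdot> \<zero>) \<cdot> (y \<cdot> \<zero>)) \<cdot> x) = ((\<diamond>x \<cdot> \<zero>) \<cdot> (\<diamond>y \<cdot> \<zero>)) \<cdot> \<diamond>x"

definition qia_compl :: "('a \<Rightarrow> 'a \<Rightarrow> 'a) \<Rightarrow> 'a \<Rightarrow> 'a \<Rightarrow> 'a" where
  "qia_compl dot zero x = dot x zero"

definition qia_join :: "('a \<Rightarrow> 'a \<Rightarrow> 'a) \<Rightarrow> 'a \<Rightarrow> 'a \<Rightarrow> 'a" where
  "qia_join dot x y = dot (dot (dot x y) (dot y x)) x"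

definition qia_meet :: "('a \<Rightarrow> 'a \<Rightarrow> 'a) \<Rightarrow> 'a \<Rightarrow> 'a \<Rightarrow> 'a \<Rightarrow> 'a" where
  "qia_meet dot zero x y =
     qia_compl dot zero (qia_join dot (qia_compl dot zero x) (qia_compl dot zero y))"

text \<open>
  The signature is \<open>\<langle>meet, join, compl, bottom, top, ex\<rangle>\<close>. The further parameters of the class
  \<open>orthomodular_lattice\<close> are instantiated: the order is the lattice order
  \<open>x \<le> y \<longleftrightarrow> meet x y = x\<close>, and difference is \<open>meet x (compl y)\<close>, which the class demands.
\<close>

locale quantum_monadic_algebra =
  orthomodular_lattice "\<lambda>x y. meet x (compl y)" compl meet
    "\<lambda>x y. meet x y = x" "\<lambda>x y. meet x y = x \<and> x \<noteq> y" join zero one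
  for meet :: "'a \<Rightarrow> 'a \<Rightarrow> 'a" and join :: "'a \<Rightarrow> 'a \<Rightarrow> 'a" and compl :: "'a \<Rightarrow> 'a"
    and zero :: 'a and one :: 'a +
  fixes ex :: "'a \<Rightarrow> 'a"
  assumes ex_zero: "ex zero = zero"
    and le_ex: "meet x (ex x) = x"
    and ex_join: "ex (join x y) = join (ex x) (ex y)"
    and ex_ex: "ex (ex x) = ex x"
    and ex_compl_ex: "ex (compl (ex x)) = compl (ex x)"

end

theory Submission
  imports Defs
begin

text \<open>
  The order is \<open>x \<le> y \<longleftrightarrow> x \<cdot> y = 1\<close>. The term \<open>(x\<^sup>\<bottom> \<cdot> y\<^sup>\<bottom>) \<cdot> x\<close> equals \<open>(x\<^sup>\<bottom> \<cdot> y\<^sup>\<bottom>) \<cdot> (x\<^sup>\<bottom> \<cdot> 0)\<close>,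
  hence is symmetric in \<open>x\<close> and \<open>y\<close> by the second axiom, and monotonicity of \<open>\<cdot>\<close> on the right
  makes it the join of \<open>x\<close> and \<open>y\<close>. That \<open>x \<oplus> y\<close> is no larger follows because \<open>b \<mapsto> b \<cdot> x\<close> is
  antitone above \<open>x\<close> and \<open>(z \<cdot> x) \<cdot> x = z\<close> for \<open>x \<le> z\<close>; the latter is also the orthomodular law.
\<close>

context quasi_implication_algebra
begin

abbreviation one ("\<one>") where
  "\<one> \<equiv> qia_one (\<cdot>)"

lemma one_dot: "\<one> \<cdot> x = x"
  by (metis absorb dot_self)

lemma dot_one: "x \<cdot> \<one> = \<one>"
  by (metis dot_exchange dot_self one_dot)

lemma dot_antisym: "x \<cdot> y = \<one> \<Longrightarrow> y \<cdot> x = \<one> \<Longrightarrow> x = y"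
  by (metis join_exchange one_dot dot_one)

lemma dot_trans: "x \<cdot> y = \<one> \<Longrightarrow> y \<cdot> z = \<one> \<Longrightarrow> x \<cdot> z = \<one>"
  by (metis dot_exchange one_dot dot_one)

lemma dot_mono_right: "y \<cdot> z = \<one> \<Longrightarrow> (x \<cdot> y) \<cdot> (x \<cdot> z) = \<one>"
  by (metis dot_exchange dot_one)

lemma dot_left_idem: "x \<cdot> (x \<cdot> y) = x \<cdot> y"
  by (metis absorb)

text \<open>As \<open>x \<cdot> y = \<one>\<close>, exchange turns
  \<open>x \<cdot> (y \<cdot> x)\<close> into
  \<open>(y \<cdot> x) \<cdot> (y \<cdot> (y \<cdot> x))\<close>, and \<open>dot_left_idem\<close>
  applies.\<close>

lemma le_dot_self: "x \<cdot> y = \<one> \<Longrightarrow> x \<cdot> (y \<cdot> x) = \<one>"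
  by (metis dot_exchange dot_self one_dot dot_left_idem)

text \<open>Exchange gives \<open>c \<cdot> x = (b \<cdot> c) \<cdot> (b \<cdot> x)\<close>; since
  \<open>b \<cdot> x\<close> lies below \<open>b \<cdot> c\<close>, \<open>le_dot_self\<close>
  applies.\<close>

lemma dot_antimono_left: "x \<cdot> c = \<one> \<Longrightarrow> c \<cdot> b = \<one> \<Longrightarrow> (b \<cdot> x) \<cdot> (c \<cdot> x) = \<one>"
  by (metis dot_exchange dot_mono_right one_dot le_dot_self)

lemma dot_dot_cancel: "x \<cdot> z = \<one> \<Longrightarrow> (z \<cdot> x) \<cdot> x = z"
  by (metis dot_one join_exchange one_dot)

lemma le_dot: "z \<cdot> a = \<one> \<Longrightarrow> z \<cdot> b = \<one> \<Longrightarrow> z \<cdot> (a \<cdot> b) = \<one>"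
  by (metis dot_mono_right dot_trans le_dot_self)

text \<open>Absorption writes \<open>x\<close> as \<open>(x \<cdot> y) \<cdot> x\<close>; two
  exchanges and \<open>dot_left_idem\<close> then lead to
  \<open>(y \<cdot> x) \<cdot> (y \<cdot> x)\<close>.\<close>

lemma le_dot_dot: "x \<cdot> ((x \<cdot> y) \<cdot> (y \<cdot> x)) = \<one>"
  by (metis absorb dot_exchange dot_self)

lemma join_commute: "qia_join (\<cdot>) x y = qia_join (\<cdot>) y x"
  unfolding qia_join_def by (rule join_exchange)

lemma join_upper1: "x \<cdot> qia_join (\<cdot>) x y = \<one>"
  unfolding qia_join_def by (metis le_dot_dot le_dot_self)

lemma join_upper2: "y \<cdot> qia_join (\<cdot>) x y = \<one>"
  by (metis join_commute join_upper1)

end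

context bounded_quasi_implication_algebra
begin

abbreviation join (infixl "\<oplus>" 65) where
  "x \<oplus> y \<equiv> qia_join (\<cdot>) x y"

abbreviation meet (infixl "\<odot>" 67) where
  "x \<odot> y \<equiv> qia_meet (\<cdot>) \<zero> x y"

abbreviation compl ("_\<^sup>\<bottom>" [1000] 1000) where
  "x\<^sup>\<bottom> \<equiv> qia_compl (\<cdot>) \<zero> x"

lemma compl_le_dot: "x\<^sup>\<bottom> \<cdot> (x \<cdot> y) = \<one>"
  unfolding qia_compl_def by (rule dot_mono_right) (rule zero_dot)

lemma compl_antimono: "x \<cdot> y = \<one> \<Longrightarrow> y\<^sup>\<bottom> \<cdot> x\<^sup>\<bottom> = \<one>"
  unfolding qia_compl_def by (metis dot_exchange le_dot_self one_dot dot_mono_right zero_dot)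

lemma compl_compl: "x\<^sup>\<bottom>\<^sup>\<bottom> = x"
  unfolding qia_compl_def
  by (metis dot_exchange dot_left_idem dot_antisym absorb dot_self dot_mono_right zero_dot)

lemma compl_dot_commute: "(x\<^sup>\<bottom> \<cdot> y\<^sup>\<bottom>) \<cdot> x = (y\<^sup>\<bottom> \<cdot> x\<^sup>\<bottom>) \<cdot> y"
  using dot_exchange[of "x\<^sup>\<bottom>" "y\<^sup>\<bottom>" \<zero>] compl_compl by (simp add: qia_compl_def)

lemma compl_dot_upper1: "x \<cdot> ((x\<^sup>\<bottom> \<cdot> y\<^sup>\<bottom>) \<cdot> x) = \<one>"
  by (metis compl_compl compl_le_dot le_dot_self)

lemma compl_dot_upper2: "y \<cdot> ((x\<^sup>\<bottom> \<cdot> y\<^sup>\<bottom>) \<cdot> x) = \<one>"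
  by (metis compl_dot_commute compl_dot_upper1)

lemma compl_dot_least:
  assumes "x \<cdot> z = \<one>" and "y \<cdot> z = \<one>"
  shows "((x\<^sup>\<bottom> \<cdot> y\<^sup>\<bottom>) \<cdot> x) \<cdot> z = \<one>"
proof -
  have "x \<cdot> (x\<^sup>\<bottom> \<cdot> z\<^sup>\<bottom>) = \<one>"
    by (metis compl_compl compl_le_dot)
  moreover have "(x\<^sup>\<bottom> \<cdot> z\<^sup>\<bottom>) \<cdot> (x\<^sup>\<bottom> \<cdot> y\<^sup>\<bottom>) = \<one>"
    by (intro dot_mono_right compl_antimono assms)
  ultimately have "((x\<^sup>\<bottom> \<cdot> y\<^sup>\<bottom>) \<cdot> x) \<cdot> ((x\<^sup>\<bottom> \<cdot> z\<^sup>\<bottom>) \<cdot> x) = \<one>"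
    by (rule dot_antimono_left)
  \<comment> \<open>By symmetry this is
    \<open>(z\<^sup>\<bottom> \<cdot> x\<^sup>\<bottom>) \<cdot> z\<close>, whose first factor is
    \<open>\<one>\<close>.\<close>
  moreover have "(x\<^sup>\<bottom> \<cdot> z\<^sup>\<bottom>) \<cdot> x = z"
    by (metis compl_dot_commute assms(1) compl_antimono one_dot)
  ultimately show ?thesis
    by simp
qed

text \<open>Exchange gives
  \<open>x\<^sup>\<bottom> = (z \<cdot> x) \<cdot> z\<^sup>\<bottom>\<close>, from which
  \<open>z \<cdot> x\<^sup>\<bottom> = x\<^sup>\<bottom>\<close>; absorption finishes.\<close>

lemma compl_dot_absorb: "x \<cdot> z = \<one> \<Longrightarrow> x\<^sup>\<bottom> \<cdot> z = z"
  unfolding qia_compl_def by (metis absorb dot_exchange one_dot)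

lemma join_eq: "x \<oplus> y = (x\<^sup>\<bottom> \<cdot> y\<^sup>\<bottom>) \<cdot> x"
proof (rule dot_antisym)
  let ?z = "(x\<^sup>\<bottom> \<cdot> y\<^sup>\<bottom>) \<cdot> x" and ?w = "(x \<cdot> y) \<cdot> (y \<cdot> x)"
  \<comment> \<open>The aim is \<open>?z \<cdot> x\<close> below \<open>?w\<close>. As
    \<open>?z \<cdot> x\<close> is the join of \<open>x\<close> and
    \<open>?z\<^sup>\<bottom>\<close>, it suffices that \<open>?w\<close> bounds both.\<close>
  have "?z\<^sup>\<bottom> \<cdot> (x \<cdot> y) = \<one>"
    by (metis compl_dot_upper1 compl_antimono compl_le_dot dot_trans)
  moreover have "?z\<^sup>\<bottom> \<cdot> (y \<cdot> x) = \<one>"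
    by (metis compl_dot_upper2 compl_antimono compl_le_dot dot_trans)
  ultimately have "?z\<^sup>\<bottom> \<cdot> ?w = \<one>"
    by (rule le_dot)
  with le_dot_dot have "((x\<^sup>\<bottom> \<cdot> ?z\<^sup>\<bottom>\<^sup>\<bottom>) \<cdot> x) \<cdot> ?w = \<one>"
    by (rule compl_dot_least)
  then have "(?z \<cdot> x) \<cdot> ?w = \<one>"
    by (simp only: compl_compl compl_dot_absorb[OF compl_dot_upper1])
  \<comment> \<open>In the chain \<open>x\<close>, \<open>?z \<cdot> x\<close>, \<open>?w\<close>,
    antitonicity puts \<open>?w \<cdot> x\<close>, which is \<open>x \<oplus> y\<close>, below
    \<open>(?z \<cdot> x) \<cdot> x = ?z\<close>.\<close>
  with le_dot_self[OF compl_dot_upper1] have "(?w \<cdot> x) \<cdot> ((?z \<cdot> x) \<cdot> x) = \<one>"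
    by (rule dot_antimono_left)
  then show "(x \<oplus> y) \<cdot> ?z = \<one>"
    by (simp only: qia_join_def dot_dot_cancel[OF compl_dot_upper1])
  show "?z \<cdot> (x \<oplus> y) = \<one>"
    by (intro compl_dot_least join_upper1 join_upper2)
qed

lemma join_least: "x \<cdot> z = \<one> \<Longrightarrow> y \<cdot> z = \<one> \<Longrightarrow> (x \<oplus> y) \<cdot> z = \<one>"
  by (simp add: join_eq compl_dot_least)

lemma meet_lower1: "(x \<odot> y) \<cdot> x = \<one>"
  using compl_antimono[OF join_upper1[of "x\<^sup>\<bottom>" "y\<^sup>\<bottom>"]] by (simp add: qia_meet_def compl_compl)

lemma meet_lower2: "(x \<odot> y) \<cdot> y = \<one>"
  using compl_antimono[OF join_upper2[of "y\<^sup>\<bottom>" "x\<^sup>\<bottom>"]] by (simp add: qia_meet_def compl_compl)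

lemma meet_greatest:
  assumes "z \<cdot> x = \<one>" and "z \<cdot> y = \<one>"
  shows "z \<cdot> (x \<odot> y) = \<one>"
  using compl_antimono[OF join_least[OF assms[THEN compl_antimono]]]
  by (simp add: qia_meet_def compl_compl)

lemma meet_eq_left_iff: "x \<odot> y = x \<longleftrightarrow> x \<cdot> y = \<one>"
  by (metis meet_lower1 meet_lower2 meet_greatest dot_antisym dot_self)

lemma meet_compl: "x \<odot> x\<^sup>\<bottom> = \<zero>"
proof (rule dot_antisym)
  have "(x \<odot> x\<^sup>\<bottom>) \<cdot> x\<^sup>\<bottom> = \<one>"
    by (rule meet_lower2)
  moreover have "x\<^sup>\<bottom> \<cdot> (x \<odot> x\<^sup>\<bottom>)\<^sup>\<bottom> = \<one>"
    by (intro compl_antimono meet_lower1)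
  ultimately have "(x \<odot> x\<^sup>\<bottom>) \<cdot> (x \<odot> x\<^sup>\<bottom>)\<^sup>\<bottom> = \<one>"
    by (rule dot_trans)
  \<comment> \<open>An element \<open>m\<close> below
    \<open>m\<^sup>\<bottom> = m \<cdot> \<zero>\<close> is below \<open>\<zero>\<close>, because
    \<open>m \<cdot> (m \<cdot> \<zero>) = m \<cdot> \<zero>\<close>.\<close>
  then show "(x \<odot> x\<^sup>\<bottom>) \<cdot> \<zero> = \<one>"
    by (simp add: qia_compl_def dot_left_idem)
qed (rule zero_dot)

lemma join_compl: "x \<oplus> x\<^sup>\<bottom> = \<one>"
  by (metis meet_compl compl_compl qia_meet_def join_commute qia_compl_def zero_dot)

text \<open>Here \<open>x\<^sup>\<bottom> \<odot> y\<close> is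
  \<open>(y \<cdot> x)\<^sup>\<bottom>\<close>, so the join formula reduces the left side to
  \<open>(y \<cdot> x) \<cdot> x\<close>, where \<open>dot_dot_cancel\<close> applies.\<close>

lemma orthomodular:
  assumes "x \<cdot> y = \<one>"
  shows "x \<oplus> (x\<^sup>\<bottom> \<odot> y) = y"
proof -
  have "y \<cdot> x = x \<oplus> y\<^sup>\<bottom>"
    by (simp add: join_eq compl_compl compl_dot_absorb assms)
  then have "x\<^sup>\<bottom> \<odot> y = (y \<cdot> x)\<^sup>\<bottom>"
    by (simp add: qia_meet_def compl_compl)
  moreover have "(y \<cdot> x)\<^sup>\<bottom>\<^sup>\<bottom> \<cdot> x = y"
    by (simp add: compl_compl dot_dot_cancel assms)
  moreover have "x\<^sup>\<bottom> \<cdot> (y \<cdot> x) = y \<cdot> x"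
    by (intro compl_dot_absorb le_dot_self assms)
  ultimately show ?thesis
    by (simp add: join_eq compl_compl)
qed

lemma orthomodular_lattice:
  "class.orthomodular_lattice (\<lambda>x y. x \<odot> y\<^sup>\<bottom>) compl meet
    (\<lambda>x y. x \<odot> y = x) (\<lambda>x y. x \<odot> y = x \<and> x \<noteq> y) join \<zero> \<one>"
  unfolding meet_eq_left_iff
proof unfold_locales
  fix x y z
  show "x \<cdot> y = \<one> \<and> x \<noteq> y \<longleftrightarrow> x \<cdot> y = \<one> \<and> y \<cdot> x \<noteq> \<one>"
    using dot_antisym dot_self by blast
  show "x \<cdot> y = \<one> \<Longrightarrow> y \<cdot> z = \<one> \<Longrightarrow> x \<cdot> z = \<one>"
    by (rule dot_trans)
qed (simp_all add: dot_self dot_one zero_dot dot_antisym meet_lower1 meet_lower2 meet_greatest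
    join_upper1 join_upper2 join_least meet_compl join_compl compl_compl compl_antimono
    orthomodular)

end

theorem theorem4p6:
  fixes dot :: "'a \<Rightarrow> 'a \<Rightarrow> 'a" and zero :: 'a and dia :: "'a \<Rightarrow> 'a"
  assumes "monadic_quasi_implication_algebra dot zero dia"
  shows "quantum_monadic_algebra (qia_meet dot zero) (qia_join dot) (qia_compl dot zero)
           zero (qia_one dot) dia"
proof -
  interpret monadic_quasi_implication_algebra dot zero dia
    by (fact assms)
  show ?thesis
  proof (intro quantum_monadic_algebra.intro quantum_monadic_algebra_axioms.intro)
    show "class.orthomodular_lattice (\<lambda>x y. qia_meet dot zero x (qia_compl dot zero y))
      (qia_compl dot zero) (qia_meet dot zero) (\<lambda>x y. qia_meet dot zero x y = x)
      (\<lambda>x y. qia_meet dot zero x y = x \<and> x \<noteq> y) (qia_join dot) zero (qia_one dot)"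
      by (rule orthomodular_lattice)
    fix x y
    show "dia zero = zero"
      by (rule dia_zero)
    show "qia_meet dot zero x (dia x) = x"
      by (simp add: meet_eq_left_iff dot_dia)
    \<comment> \<open>The axiom \<open>dia_join\<close> is stated for
      \<open>(x\<^sup>\<bottom> \<cdot> y\<^sup>\<bottom>) \<cdot> x\<close>, which
      \<open>join_eq\<close> identifies with the join.\<close>
    show "dia (qia_join dot x y) = qia_join dot (dia x) (dia y)"
      using dia_join by (simp add: join_eq qia_compl_def)
    show "dia (dia x) = dia x"
      by (rule dot_antisym[OF dia_dia_dot dot_dia])
    show "dia (qia_compl dot zero (dia x)) = qia_compl dot zero (dia x)"
      unfolding qia_compl_def by (rule dia_compl_dia)
  qed
qed

end
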